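(* Let $\mathcal{A}$ be an algebra over a field $F$ which is either a Novikov algebra or a bicommutative algebra, and let $\mathcal{A}=A_1\supseteq A_2\supseteq\cdots\supseteq A_m\supseteq\cdots$ be a chain of ideals of $\mathcal{A}$ satisfying $\mathcal{A}\circ A_i\subseteq A_{i+1}$ for all $i\ge 1$. Define a series of ideals inductively by $H_1=\mathcal{A}$ and $H_{i+1}=\mathcal{A}\circ H_i$ for $i\ge 1$. Then $H_pH_q\subseteq H_{p+q-1}$ for all positive integers $p$ and $q$. Moreover, if $\mathcal{A}$ is of finite class, then $\mathcal{A}\circ\mathcal{A}$ is nilpotent of nilpotent index less than or equal to the class of $\mathcal{A}$.
   Context: An algebra over a field $F$ is an $F$-vector space with a bilinear multiplication (not necessarily associative or unital); "ideal" means two-sided ideal. A (left) Novikov algebra is an algebra satisfying $(xy)z=(xz)y$ (right commutativity) and $(xy)z-x(yz)=(yx)z-y(xz)$ (left symmetry) for all $x,y,z$. A bicommutative algebra is an algebra satisfying $x(yz)=y(xz)$ (left commutativity) and $(xy)z=(xz)y$ (right commutativity) for all $x,y,z$. Write $[a,b]=ab-ba$. For subspaces $A,B$ of $\mathcal{A}$, $[A,B]$ is the linear span of all $[a,b]$ with $a\in A$, $b\in B$; $AB$ is the linear span of all $ab$ with $a\in A$, $b\in B$; and $A\circ B$ is the ideal of $\mathcal{A}$ generated by $[A,B]$ (so $A\circ B=B\circ A$). The algebra $\mathcal{A}$ is of finite class if $H_n=(0)$ for some positive integer $n$; for the minimal such $n$, the class of $\mathcal{A}$ is $n-1$. For a subspace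 $V$ of $\mathcal{A}$, put $V^1=V$ and $V^n=\sum_{1\le i\le n-1}V^iV^{n-i}$ for $n\ge 2$; $V$ is nilpotent if $V^n=(0)$ for some positive integer $n$, and its nilpotent index is the least such $n$.
   Formalization: The bound of the nilpotent index by the class is stated only for a nonzero algebra: the zero algebra has class 0, while the nilpotent index of its zero ideal is 1, so the bound fails there. *)

theory Defs
  imports Complex_Main
begin

text \<open>Algebras are neither associative nor unital in general, so the multiplication is an
  explicit parameter. The algebra itself is the whole type, i.e. \<^term>\<open>UNIV\<close>.\<close>

locale nonassoc_algebra = vector_space scale
  for scale :: "'f::field \<Rightarrow> 'v::ab_group_add \<Rightarrow> 'v" +
  fixes mult :: "'v \<Rightarrow> 'v \<Rightarrow> 'v"  (infixl "\<cdot>" 70)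
  assumes linear_mult_right: "Vector_Spaces.linear scale scale (\<lambda>y. x \<cdot> y)"
    and linear_mult_left: "Vector_Spaces.linear scale scale (\<lambda>x. x \<cdot> y)"
begin

definition two_sided_ideal :: "'v set \<Rightarrow> bool" where
  "two_sided_ideal I \<longleftrightarrow> subspace I \<and> (\<forall>a\<in>I. \<forall>x. x \<cdot> a \<in> I \<and> a \<cdot> x \<in> I)"

definition commutator :: "'v \<Rightarrow> 'v \<Rightarrow> 'v" where
  "commutator a b = a \<cdot> b - b \<cdot> a"

definition commutator_space :: "'v set \<Rightarrow> 'v set \<Rightarrow> 'v set" where
  "commutator_space A B = span {commutator a b | a b. a \<in> A \<and> b \<in> B}"

definition product_space :: "'v set \<Rightarrow> 'v set \<Rightarrow> 'v set" where
  "product_space A B = span {a \<cdot> b | a b. a \<in> A \<and> b \<in> B}"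

definition circ :: "'v set \<Rightarrow> 'v set \<Rightarrow> 'v set" where
  "circ A B = two_sided_ideal hull (commutator_space A B)"

text \<open>The series \<open>H\<^sub>1 = \<A>\<close>, \<open>H\<^sub>i\<^sub>+\<^sub>1 = \<A> \<circ> H\<^sub>i\<close>. Indexing starts at 1; the value at 0 is
  never used.\<close>

primrec H :: "nat \<Rightarrow> 'v set" where
  "H 0 = UNIV"
| "H (Suc i) = (if i = 0 then UNIV else circ UNIV (H i))"

definition finite_class :: bool where
  "finite_class \<longleftrightarrow> (\<exists>n\<ge>1. H n = {0})"

definition algebra_class :: nat where
  "algebra_class = (LEAST n. n \<ge> 1 \<and> H n = {0}) - 1"

text \<open>The powers \<open>V\<^sup>n\<close> for \<open>n \<ge> 1\<close> (the value at 0 is never used). The sum of the subspaces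
  \<open>V\<^sup>i V\<^sup>n\<^sup>-\<^sup>i\<close> is the span of their union.\<close>

fun subspace_power :: "'v set \<Rightarrow> nat \<Rightarrow> 'v set" where
  "subspace_power V n =
     (if n \<le> 1 then V
      else span (\<Union>i\<in>{1..n - 1}. product_space (subspace_power V i) (subspace_power V (n - i))))"

declare subspace_power.simps [simp del]

definition nilpotent :: "'v set \<Rightarrow> bool" where
  "nilpotent V \<longleftrightarrow> (\<exists>n\<ge>1. subspace_power V n = {0})"

definition nilpotent_index :: "'v set \<Rightarrow> nat" where
  "nilpotent_index V = (LEAST n. n \<ge> 1 \<and> subspace_power V n = {0})"

end

locale novikov_algebra = nonassoc_algebra +
  assumes right_commutative: "(x \<cdot> y) \<cdot> z = (x \<cdot> z) \<cdot> y"
    and left_symmetric: "(x \<cdot> y) \<cdot> z - x \<cdot> (y \<cdot> z) = (y \<cdot> x) \<cdot> z - y \<cdot> (x \<cdot> z)"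

locale bicommutative_algebra = nonassoc_algebra +
  assumes left_commutative: "x \<cdot> (y \<cdot> z) = y \<cdot> (x \<cdot> z)"
    and right_commutative: "(x \<cdot> y) \<cdot> z = (x \<cdot> z) \<cdot> y"

end

theory Submission
  imports Defs
begin

text \<open>
  Right commutativity makes the associator a difference of commutator expressions,
  \<open>(x, y, z) = [x, y]z - [x, yz]\<close>, and in both kinds of algebra the commutator satisfies the
  Jacobi identity. Hence products and commutators are best estimated together: by induction on
  \<open>p\<close>, for all \<open>q\<close> at once,
  \<open>H\<^sub>q H\<^sub>p \<subseteq> H\<^sub>q\<^sub>+\<^sub>p\<^sub>-\<^sub>1\<close> and \<open>[H\<^sub>q, H\<^sub>p] \<subseteq> H\<^sub>q\<^sub>+\<^sub>p\<close>.
  The commutator estimate is that of a lower central series: an element of \<open>H\<^sub>p\<^sub>+\<^sub>1\<close> is made from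
  \<open>[b, g]\<close> with \<open>g \<in> H\<^sub>p\<close>, and the Jacobi identity trades it for \<open>[b, [x, g]]\<close> and
  \<open>[[b, x], g]\<close>, where \<open>[b, x] \<in> H\<^sub>q\<^sub>+\<^sub>1\<close>. The product estimate then follows because
  \<open>x[b, g]\<close> is a combination of commutators (bicommutative case) or of associators (Novikov case).

  The remaining point is which elements generate \<open>\<A> \<circ> I\<close> as a subspace, for an ideal \<open>I\<close>.
  In a bicommutative algebra \<open>[\<A>, I]\<close> is already an ideal. In a Novikov algebra one has
  \<open>2[a, u]x = [ax, u] + [a, ux]\<close>, which says the same as long as one can divide by 2; over an
  arbitrary field \<open>\<A> \<circ> I = [\<A>, I] + [\<A>, I]\<A>\<close>. The elements \<open>[b, g]w\<close> that this adds to the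
  induction step cost the associator \<open>(x, [b, g], w)\<close>. It is handled by an identity in which
  the sum of \<open>([x, y], z, w)\<close> over the cyclic permutations of \<open>x, y, z\<close> vanishes
  (\<open>associator_commutator_middle\<close>), a Jacobi identity inside an associator, so that no division
  by 2 is needed.

  Nilpotency is a matter of counting: \<open>V = \<A> \<circ> \<A> = H\<^sub>2\<close> has \<open>V\<^sup>n \<subseteq> H\<^sub>n\<^sub>+\<^sub>1\<close>, since
  \<open>H\<^sub>i\<^sub>+\<^sub>1 H\<^sub>n\<^sub>-\<^sub>i\<^sub>+\<^sub>1 \<subseteq> H\<^sub>n\<^sub>+\<^sub>1\<close>.
\<close>

section \<open>Ideals and the commutator series in an arbitrary algebra\<close>

context nonassoc_algebra
begin

lemma mult_add_right: "x \<cdot> (y + z) = x \<cdot> y + x \<cdot> z"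
  using linear_mult_right[of x] by (simp add: linear_iff_module_hom module_hom.add)

lemma mult_add_left: "(x + y) \<cdot> z = x \<cdot> z + y \<cdot> z"
  using linear_mult_left[of z, unfolded linear_iff_module_hom, THEN module_hom.add] .

lemma mult_scale_right: "x \<cdot> scale r y = scale r (x \<cdot> y)"
  using linear_mult_right[of x] by (simp add: linear_iff_module_hom module_hom.scale)

lemma mult_scale_left: "scale r x \<cdot> y = scale r (x \<cdot> y)"
  using linear_mult_left[of y, unfolded linear_iff_module_hom, THEN module_hom.scale] .

lemma mult_diff_right: "x \<cdot> (y - z) = x \<cdot> y - x \<cdot> z"
  by (metis add_diff_cancel diff_add_cancel mult_add_right)

lemma mult_diff_left: "(x - y) \<cdot> z = x \<cdot> z - y \<cdot> z"
  by (metis add_diff_cancel diff_add_cancel mult_add_left)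

lemma mult_zero_right: "x \<cdot> 0 = 0"
  using mult_diff_right[of x 0 0] by simp

lemma mult_zero_left: "0 \<cdot> x = 0"
  using mult_diff_left[of 0 0 x] by simp

lemmas mult_linear = mult_add_right mult_add_left mult_scale_right mult_scale_left
  mult_diff_right mult_diff_left mult_zero_right mult_zero_left

definition associator :: "'v \<Rightarrow> 'v \<Rightarrow> 'v \<Rightarrow> 'v" where
  "associator x y z = (x \<cdot> y) \<cdot> z - x \<cdot> (y \<cdot> z)"

text \<open>Products and commutators with \<open>x\<close> are estimated simultaneously, so the generators of an
  ideal are tested against both conditions at once.\<close>

lemma subspace_mult_commutator_vimage:
  assumes "subspace K" and "subspace L"
  shows "subspace {v. x \<cdot> v \<in> K \<and> commutator x v \<in> L}"
proof -
  have "commutator x (v + w) = commutator x v + commutator x w"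
    and "commutator x (scale r v) = scale r (commutator x v)" for v w r
    by (simp_all add: commutator_def mult_linear scale_right_diff_distrib)
  moreover have "commutator x 0 = 0" by (simp add: commutator_def mult_linear)
  ultimately show ?thesis using assms by (auto simp: subspace_def mult_linear)
qed

lemma ideal_subspace: "two_sided_ideal I \<Longrightarrow> subspace I"
  by (simp add: two_sided_ideal_def)

lemma ideal_mult_left: "two_sided_ideal I \<Longrightarrow> a \<in> I \<Longrightarrow> x \<cdot> a \<in> I"
  by (simp add: two_sided_ideal_def)

lemma ideal_mult_right: "two_sided_ideal I \<Longrightarrow> a \<in> I \<Longrightarrow> a \<cdot> x \<in> I"
  by (simp add: two_sided_ideal_def)

lemma ideal_commutator: "two_sided_ideal I \<Longrightarrow> u \<in> I \<Longrightarrow> commutator a u \<in> I"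
  unfolding commutator_def
  by (intro subspace_diff ideal_subspace ideal_mult_left ideal_mult_right)

lemma ideal_UNIV: "two_sided_ideal UNIV"
  by (simp add: two_sided_ideal_def)

lemma ideal_Inter: "(\<And>I. I \<in> \<I> \<Longrightarrow> two_sided_ideal I) \<Longrightarrow> two_sided_ideal (\<Inter>\<I>)"
  unfolding two_sided_ideal_def by (blast intro: subspace_Inter)

lemma ideal_circ: "two_sided_ideal (circ A B)"
  unfolding circ_def by (rule hull_in) (simp add: ideal_Inter)

lemma commutator_in_circ: "a \<in> A \<Longrightarrow> b \<in> B \<Longrightarrow> commutator a b \<in> circ A B"
  unfolding circ_def commutator_space_def
  by (rule subsetD[OF hull_subset]) (auto intro: span_base)

lemma circ_least:
  assumes "two_sided_ideal J" and "\<And>a b. a \<in> A \<Longrightarrow> b \<in> B \<Longrightarrow> commutator a b \<in> J"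
  shows "circ A B \<subseteq> J"
  unfolding circ_def commutator_space_def using assms
  by (intro hull_minimal span_minimal) (auto simp: ideal_subspace)

lemma ideal_span:
  assumes "\<And>g x. g \<in> G \<Longrightarrow> x \<cdot> g \<in> span G \<and> g \<cdot> x \<in> span G"
  shows "two_sided_ideal (span G)"
proof -
  have "x \<cdot> a \<in> span G \<and> a \<cdot> x \<in> span G" if "a \<in> span G" for a x
    using that
  proof (induction rule: span_induct)
    case base
    show ?case by (auto simp: subspace_def mult_linear span_add span_scale span_zero)
  next
    case (step g)
    then show ?case using assms by blast
  qed
  then show ?thesis by (auto simp: two_sided_ideal_def)
qed

lemma H_Suc: "1 \<le> i \<Longrightarrow> H (Suc i) = circ UNIV (H i)"
  by simp

lemma ideal_H: "two_sided_ideal (H i)"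
  by (cases i) (auto simp: ideal_UNIV ideal_circ)

lemma subspace_H: "subspace (H i)"
  by (simp add: ideal_H ideal_subspace)

lemma H_add: "x \<in> H i \<Longrightarrow> y \<in> H i \<Longrightarrow> x + y \<in> H i"
  by (simp add: subspace_H subspace_add)

lemma H_diff: "x \<in> H i \<Longrightarrow> y \<in> H i \<Longrightarrow> x - y \<in> H i"
  by (simp add: subspace_H subspace_diff)

lemma H_mult_right: "u \<in> H i \<Longrightarrow> u \<cdot> x \<in> H i"
  by (simp add: ideal_H ideal_mult_right)

lemma commutator_H: "1 \<le> i \<Longrightarrow> u \<in> H i \<Longrightarrow> commutator a u \<in> H (Suc i)"
  by (simp only: H_Suc commutator_in_circ UNIV_I)

lemma commutator_swap: "commutator x y = - commutator y x"
  by (simp add: commutator_def)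

lemma commutator_H_right: "1 \<le> i \<Longrightarrow> u \<in> H i \<Longrightarrow> commutator u a \<in> H (Suc i)"
  using commutator_H[of i u a] subspace_neg[OF subspace_H]
  by (simp add: commutator_swap[of u a] del: H.simps)

lemma H_decreasing: "1 \<le> i \<Longrightarrow> H (Suc i) \<subseteq> H i"
  by (simp only: H_Suc) (intro circ_least ideal_H ideal_commutator)

lemma product_space_H_subset:
  assumes "\<And>x y. x \<in> H p \<Longrightarrow> y \<in> H q \<Longrightarrow> x \<cdot> y \<in> H r"
  shows "product_space (H p) (H q) \<subseteq> H r"
  unfolding product_space_def using assms by (intro span_minimal) (auto simp: subspace_H)

text \<open>The exponent shift comes from \<open>H\<^sub>2\<close> having weight one in the filtration in which \<open>H\<^sub>i\<close>
  has weight \<open>i - 1\<close>; in terms of weights the hypothesis says that products add them.\<close>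

lemma subspace_power_H_2:
  assumes "\<forall>p\<ge>1. \<forall>q\<ge>1. product_space (H p) (H q) \<subseteq> H (p + q - 1)" and "1 \<le> n"
  shows "subspace_power (H 2) n \<subseteq> H (Suc n)"
  using assms(2)
proof (induction n rule: less_induct)
  case (less n)
  show ?case
  proof (cases "n = 1")
    case True
    then show ?thesis by (subst subspace_power.simps) (simp add: numeral_2_eq_2)
  next
    case False
    have "product_space (subspace_power (H 2) i) (subspace_power (H 2) (n - i)) \<subseteq> H (Suc n)"
      if i: "i \<in> {1..n - 1}" for i
    proof -
      have "subspace_power (H 2) i \<subseteq> H (Suc i)"
        and "subspace_power (H 2) (n - i) \<subseteq> H (Suc (n - i))"
        using i False less.prems by (intro less.IH; auto)+
      then have "product_space (subspace_power (H 2) i) (subspace_power (H 2) (n - i))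
          \<subseteq> product_space (H (Suc i)) (H (Suc (n - i)))"
        unfolding product_space_def by (intro span_mono) blast
      also have "\<dots> \<subseteq> H (Suc i + Suc (n - i) - 1)"
        by (intro assms(1)[rule_format]) auto
      also have "Suc i + Suc (n - i) - 1 = Suc n"
        using i by auto
      finally show ?thesis .
    qed
    then have "span (\<Union>i\<in>{1..n - 1}.
        product_space (subspace_power (H 2) i) (subspace_power (H 2) (n - i))) \<subseteq> H (Suc n)"
      by (intro span_minimal subspace_H) blast
    then show ?thesis
      using False less.prems by (subst subspace_power.simps) auto
  qed
qed

lemma circ_UNIV_power_zero:
  assumes "\<forall>p\<ge>1. \<forall>q\<ge>1. product_space (H p) (H q) \<subseteq> H (p + q - 1)"
    and "H (Suc n) = {0}" and "1 \<le> n"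
  shows "subspace_power (circ UNIV UNIV) n = {0}"
proof -
  have H2: "H 2 = circ UNIV UNIV" by (simp add: numeral_2_eq_2)
  have "subspace (subspace_power (H 2) n)"
    using subspace_H[of 2] by (subst subspace_power.simps) simp
  then have "0 \<in> subspace_power (H 2) n" by (rule subspace_0)
  then show ?thesis
    using subspace_power_H_2[OF assms(1,3)] assms(2) H2 by auto
qed

lemma circ_UNIV_nilpotent:
  assumes prod: "\<forall>p\<ge>1. \<forall>q\<ge>1. product_space (H p) (H q) \<subseteq> H (p + q - 1)"
    and "finite_class"
  shows "nilpotent (circ UNIV UNIV)
    \<and> ((UNIV :: 'v set) \<noteq> {0} \<longrightarrow> nilpotent_index (circ UNIV UNIV) \<le> algebra_class)"
proof -
  define N where "N = (LEAST n. n \<ge> 1 \<and> H n = {0})"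
  have N: "N \<ge> 1 \<and> H N = {0}"
    unfolding N_def using assms(2) LeastI_ex[of "\<lambda>n. n \<ge> 1 \<and> H n = {0}"]
    by (auto simp: finite_class_def)
  show ?thesis
  proof (cases "N = 1")
    case True
    \<comment> \<open>The zero algebra has class 0, whereas nilpotency exponents start at 1. This is why the
      bound on the index is asserted for nonzero algebras only.\<close>
    then have "(UNIV :: 'v set) = {0}" using N by simp
    moreover have "0 \<in> circ UNIV UNIV"
      by (rule subspace_0[OF ideal_subspace[OF ideal_circ]])
    ultimately have "subspace_power (circ UNIV UNIV) 1 = {0}"
      by (subst subspace_power.simps) (auto, metis UNIV_I singletonD)
    then show ?thesis
      using \<open>UNIV = {0}\<close> by (auto simp: nilpotent_def)
  next
    case False
    then have "1 \<le> N - 1" and "H (Suc (N - 1)) = {0}" using N by auto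
    then have "subspace_power (circ UNIV UNIV) (N - 1) = {0}"
      using circ_UNIV_power_zero[OF prod] by blast
    then show ?thesis
      using \<open>1 \<le> N - 1\<close> unfolding nilpotent_def nilpotent_index_def algebra_class_def
        N_def[symmetric]
      by (auto intro: Least_le)
  qed
qed

end

section \<open>Bicommutative algebras\<close>

context bicommutative_algebra
begin

text \<open>Multiplication by \<open>x\<close>, on either side, acts on a commutator \<open>[a, b]\<close> by commutators whose
  second entry is \<open>b\<close> or a product with the factor \<open>b\<close>. This is what makes \<open>[\<A>, I]\<close> an ideal.\<close>

lemma mult_commutator: "x \<cdot> commutator a b = commutator a (x \<cdot> b) + commutator (x \<cdot> a) b"
  using left_commutative[of x a b] left_commutative[of x b a] right_commutative[of x a b]
  by (simp add: commutator_def mult_linear algebra_simps)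

lemma commutator_mult: "commutator a b \<cdot> x = commutator (a \<cdot> x) b + commutator a (b \<cdot> x)"
  using right_commutative[of a b x] right_commutative[of b a x] left_commutative[of a b x]
  by (simp add: commutator_def mult_linear algebra_simps)

lemma jacobi_identity:
  "commutator x (commutator b g)
    = commutator b (commutator x g) - commutator (commutator b x) g"
proof -
  have "commutator x (commutator b g) = x \<cdot> commutator b g - commutator b g \<cdot> x"
    by (simp add: commutator_def)
  also have "\<dots> = commutator b (commutator x g) - commutator (commutator b x) g"
    unfolding commutator_mult mult_commutator
    by (simp add: commutator_def mult_linear algebra_simps)
  finally show ?thesis .
qed

lemma circ_UNIV_subset:
  assumes "two_sided_ideal I" and "subspace S" and "\<And>a u. u \<in> I \<Longrightarrow> commutator a u \<in> S"
  shows "circ UNIV I \<subseteq> S"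
proof -
  let ?G = "{commutator a u | a u. u \<in> I}"
  have base: "commutator a u \<in> span ?G" if "u \<in> I" for a u
    using that by (auto intro: span_base)
  have "two_sided_ideal (span ?G)"
  proof (rule ideal_span)
    fix g x
    assume "g \<in> ?G"
    then obtain a u where "g = commutator a u" and "u \<in> I" by blast
    then show "x \<cdot> g \<in> span ?G \<and> g \<cdot> x \<in> span ?G"
      using assms(1) by (simp add: mult_commutator commutator_mult span_add base
          ideal_mult_left ideal_mult_right)
  qed
  then have "circ UNIV I \<subseteq> span ?G"
    by (rule circ_least) (auto intro: base)
  also have "\<dots> \<subseteq> S"
    using assms(2,3) by (intro span_minimal) auto
  finally show ?thesis .
qed

text \<open>The inductive hypothesis is used for \<open>x \<in> H\<^sub>q\<close> and \<open>xb \<in> H\<^sub>q\<close>, but also for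
  \<open>[b, x] \<in> H\<^sub>q\<^sub>+\<^sub>1\<close>, so \<open>q\<close> has to vary in the induction on \<open>p\<close>.\<close>

lemma mult_commutator_H_H:
  "1 \<le> p \<Longrightarrow> 1 \<le> q \<Longrightarrow> x \<in> H q \<Longrightarrow> v \<in> H p
    \<Longrightarrow> x \<cdot> v \<in> H (q + p - 1) \<and> commutator x v \<in> H (q + p)"
proof (induction p arbitrary: q x v rule: nat_induct_at_least)
  case base
  then show ?case
    using commutator_H_right by (simp add: H_mult_right del: H.simps)
next
  case (Suc p)
  have "circ UNIV (H p) \<subseteq> {v. x \<cdot> v \<in> H (q + p) \<and> commutator x v \<in> H (Suc (q + p))}"
  proof (intro circ_UNIV_subset ideal_H subspace_mult_commutator_vimage subspace_H CollectI conjI)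
    fix b g
    assume g: "g \<in> H p"
    have "x \<cdot> g \<in> H (q + p - 1)" and "commutator x g \<in> H (q + p)"
      and "commutator (x \<cdot> b) g \<in> H (q + p)"
      using Suc.IH[of q] Suc.prems g by (auto intro: H_mult_right)
    moreover have "commutator (commutator b x) g \<in> H (Suc q + p)"
      using Suc.IH[of "Suc q" "commutator b x" g] commutator_H[of q x b] Suc.prems g
      by (simp del: H.simps)
    ultimately show "x \<cdot> commutator b g \<in> H (q + p)"
      and "commutator x (commutator b g) \<in> H (Suc (q + p))"
      using commutator_H[of "q + p - 1" "x \<cdot> g" b] commutator_H[of "q + p" "commutator x g" b]
        Suc.hyps Suc.prems
      by (simp_all add: mult_commutator jacobi_identity[of x b g] H_add H_diff del: H.simps)
  qed
  then show ?case using Suc by (auto simp: H_Suc simp del: H.simps)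
qed

end

section \<open>Novikov algebras\<close>

context novikov_algebra
begin

lemma associator_left_symmetric: "associator x y z = associator y x z"
  by (simp add: associator_def left_symmetric)

lemma associator_mult: "associator x y z \<cdot> w = associator (x \<cdot> w) y z"
  using right_commutative[of "x \<cdot> y" z w] right_commutative[of x y w]
    right_commutative[of x "y \<cdot> z" w]
  by (simp add: associator_def mult_linear)

text \<open>In the model where \<open>xy\<close> stands for \<open>x y'\<close> in a commutative differential algebra, the
  associator \<open>(x, y, z)\<close> is \<open>- x y z''\<close>. Both sides below then equal \<open>- x w' y z''\<close>.\<close>

lemma associator_swap: "associator (x \<cdot> w) y z = associator (y \<cdot> w) x z"
  by (metis associator_mult associator_left_symmetric)

text \<open>By left symmetry this says that the sum of \<open>([x, b], g, w)\<close> over the cyclic permutations of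
  \<open>x, b, g\<close> is zero: its six terms cancel in pairs by swapping. It trades the
  commutator \<open>[b, g]\<close> for \<open>[b, x]\<close> and \<open>[x, g]\<close>, to which an induction on the level of \<open>g\<close> applies.\<close>

lemma associator_commutator_middle:
  "associator x (commutator b g) w
    = associator (commutator b x) g w + associator b (commutator x g) w"
proof -
  have *: "associator (commutator y z) v w = associator (y \<cdot> z) v w - associator (z \<cdot> y) v w"
    for y z v by (simp add: commutator_def associator_def mult_linear algebra_simps)
  have "associator (commutator b g) x w
      = associator (commutator b x) g w + associator (commutator x g) b w"
    unfolding * using associator_swap[of b g x w] associator_swap[of g b x w]
      associator_swap[of b x g w] by (simp add: algebra_simps)
  then show ?thesis by (metis associator_left_symmetric)
qed

lemma associator_commutator:
  "associator x y z = commutator x y \<cdot> z - commutator x (y \<cdot> z)"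
  using right_commutative[of y x z] by (simp add: associator_def commutator_def mult_linear)

text \<open>Two right multiplications of a commutator reduce to single ones: right commutativity lets
  \<open>x\<close> and \<open>y\<close> be absorbed into the entries, and the terms \<open>(ax)(by)\<close> and \<open>(by)(ax)\<close> left over
  combine to a commutator. If \<open>b\<close> lies in an ideal, so do all the second entries.\<close>

lemma commutator_mult_mult:
  "(commutator a b \<cdot> x) \<cdot> y
    = commutator (a \<cdot> x) b \<cdot> y + commutator a (b \<cdot> y) \<cdot> x - commutator (a \<cdot> x) (b \<cdot> y)"
proof -
  have "((a \<cdot> b) \<cdot> x) \<cdot> y = ((a \<cdot> x) \<cdot> b) \<cdot> y" by (simp add: right_commutative[of a b x])
  moreover have "((b \<cdot> a) \<cdot> x) \<cdot> y = ((b \<cdot> y) \<cdot> a) \<cdot> x"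
    by (metis right_commutative)
  moreover have "(b \<cdot> (a \<cdot> x)) \<cdot> y = (b \<cdot> y) \<cdot> (a \<cdot> x)" by (rule right_commutative)
  moreover have "(a \<cdot> (b \<cdot> y)) \<cdot> x = (a \<cdot> x) \<cdot> (b \<cdot> y)" by (rule right_commutative)
  ultimately show ?thesis by (simp add: commutator_def mult_linear algebra_simps)
qed

text \<open>The terms \<open>(xb)a\<close> and \<open>(xa)b\<close> cancel, leaving \<open>(x, b, a) - (x, a, b)\<close>. The second
  associator is written with \<open>a\<close> first because its expansion into commutators then starts with
  \<open>[a, x]\<close>, which is in \<open>H\<^sub>q\<^sub>+\<^sub>1\<close> when \<open>x \<in> H\<^sub>q\<close>.\<close>

lemma mult_commutator: "x \<cdot> commutator a b = associator x b a - associator a x b"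
  using right_commutative[of x a b] left_symmetric[of a x b]
  by (simp add: commutator_def associator_def mult_linear)

text \<open>Unlike the preceding form, this one has \<open>b\<close> or \<open>xb\<close> as the second entry of every
  commutator, as needed to stay in \<open>[\<A>, I] + [\<A>, I]\<A>\<close> when \<open>b \<in> I\<close>.\<close>

lemma mult_commutator_symmetric:
  "x \<cdot> commutator a b = commutator a (x \<cdot> b) + commutator (x \<cdot> a) b - commutator a b \<cdot> x"
proof -
  have "x \<cdot> commutator a b = associator b x a - associator a x b"
    using mult_commutator[of x a b] associator_left_symmetric[of x b a] by simp
  moreover have "\<dots> = commutator a (x \<cdot> b) + commutator (x \<cdot> a) b - commutator a b \<cdot> x"
    by (simp add: commutator_def associator_def mult_linear right_commutative[of a b x]
        right_commutative[of b a x] right_commutative[of x b a])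
  ultimately show ?thesis by simp
qed

text \<open>Left symmetry alone suffices: the alternating sum of associators over all orders vanishes.\<close>

lemma jacobi_identity:
  "commutator x (commutator b g)
    = commutator b (commutator x g) - commutator (commutator b x) g"
proof -
  have "commutator x (commutator b g) - commutator b (commutator x g)
        + commutator (commutator b x) g
      = (associator b x g - associator x b g) + (associator x g b - associator g x b)
        + (associator g b x - associator b g x)"
    by (simp add: commutator_def associator_def mult_linear)
  also have "\<dots> = 0"
    using associator_left_symmetric[of b x g] associator_left_symmetric[of x g b]
      associator_left_symmetric[of g b x] by simp
  finally show ?thesis by (simp add: algebra_simps)
qed

text \<open>This is \<open>\<A> \<circ> I = [\<A>, I] + [\<A>, I]\<A>\<close>, in the form of a rule for proving that a subspace
  contains \<open>\<A> \<circ> I\<close>. Left symmetry moves a left factor past a right one, so closure under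
  right multiplication is the essential part.\<close>

lemma circ_UNIV_subset:
  assumes I: "two_sided_ideal I" and "subspace S"
    and "\<And>a u. u \<in> I \<Longrightarrow> commutator a u \<in> S"
    and "\<And>a u y. u \<in> I \<Longrightarrow> commutator a u \<in> S \<Longrightarrow> commutator a u \<cdot> y \<in> S"
  shows "circ UNIV I \<subseteq> S"
proof -
  let ?G = "{commutator a u | a u. u \<in> I} \<union> {commutator a u \<cdot> y | a u y. u \<in> I}"
  have base: "commutator a u \<in> span ?G" "commutator a u \<cdot> y \<in> span ?G" if "u \<in> I" for a u y
    by (rule span_base, use that in blast)+
  have right: "(commutator a u \<cdot> y) \<cdot> x \<in> span ?G" if "u \<in> I" for a u x y
    unfolding commutator_mult_mult using that I
    by (intro span_add span_diff base ideal_mult_right)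
  have left: "x \<cdot> commutator a u \<in> span ?G" if "u \<in> I" for a u x
    unfolding mult_commutator_symmetric using that I
    by (intro span_add span_diff base ideal_mult_left)
  have left_mult: "x \<cdot> (commutator a u \<cdot> y) \<in> span ?G" if u: "u \<in> I" for a u x y
  proof -
    let ?c = "commutator a u"
    have "x \<cdot> (?c \<cdot> y) = (x \<cdot> ?c - ?c \<cdot> x) \<cdot> y + ?c \<cdot> (x \<cdot> y)"
      using left_symmetric[of x ?c y] by (simp add: mult_linear algebra_simps)
    also have "\<dots> = commutator a (x \<cdot> u) \<cdot> y + commutator (x \<cdot> a) u \<cdot> y
        - (?c \<cdot> x) \<cdot> y - (?c \<cdot> x) \<cdot> y + ?c \<cdot> (x \<cdot> y)"
      by (simp add: mult_commutator_symmetric mult_linear)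
    finally show ?thesis
      using u I by (simp only:) (intro span_add span_diff base right ideal_mult_left)
  qed
  have "two_sided_ideal (span ?G)"
  proof (rule ideal_span)
    fix g x
    assume "g \<in> ?G"
    then consider (1) a u where "g = commutator a u" "u \<in> I"
      | (2) a u y where "g = commutator a u \<cdot> y" "u \<in> I" by blast
    then show "x \<cdot> g \<in> span ?G \<and> g \<cdot> x \<in> span ?G"
      by cases (simp_all only: left left_mult right base simp_thms)
  qed
  then have "circ UNIV I \<subseteq> span ?G"
    by (rule circ_least) (rule base(1))
  also have "\<dots> \<subseteq> S"
    using assms by (intro span_minimal) auto
  finally show ?thesis .
qed

lemma associator_H_middle: "1 \<le> i \<Longrightarrow> u \<in> H i \<Longrightarrow> associator x u w \<in> H (Suc i)"
  unfolding associator_commutator by (intro H_diff H_mult_right commutator_H)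

text \<open>The first case of the step is \<open>[b, g]\<close>: the product \<open>x[b, g]\<close> is a difference of two
  associators with entries in \<open>H\<^sub>q\<close> and \<open>H\<^sub>p\<close>, each of which expands into commutators covered by
  the inductive hypothesis. The second case is \<open>[b, g]w\<close>, which differs from the first by the
  associator \<open>(x, [b, g], w)\<close>; this has to be in \<open>H\<^sub>q\<^sub>+\<^sub>p\<^sub>+\<^sub>1\<close>, one level deeper than the
  product \<open>x[b, g]\<close>, because it also enters the commutator \<open>[x, [b, g]w]\<close>.\<close>

lemma mult_commutator_H_H:
  "1 \<le> p \<Longrightarrow> 1 \<le> q \<Longrightarrow> x \<in> H q \<Longrightarrow> v \<in> H p
    \<Longrightarrow> x \<cdot> v \<in> H (q + p - 1) \<and> commutator x v \<in> H (q + p)"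
proof (induction p arbitrary: q x v rule: nat_induct_at_least)
  case base
  then show ?case
    using commutator_H_right by (simp add: H_mult_right del: H.simps)
next
  case (Suc p)
  have IH: "y \<cdot> g \<in> H (r + p - 1)" "commutator y g \<in> H (r + p)"
    if "1 \<le> r" "y \<in> H r" "g \<in> H p" for r y g
    using Suc.IH that by auto
  have associator: "associator y g w \<in> H (r + p)"
    if "1 \<le> r" "y \<in> H r" "g \<in> H p" for r y g w
    unfolding associator_commutator using that by (intro H_diff H_mult_right IH)
  have "circ UNIV (H p) \<subseteq> {v. x \<cdot> v \<in> H (q + p) \<and> commutator x v \<in> H (Suc (q + p))}"
  proof (intro circ_UNIV_subset ideal_H subspace_mult_commutator_vimage subspace_H CollectI)
    fix b g
    assume g: "g \<in> H p"
    have bx: "commutator b x \<in> H (Suc q)" using Suc.prems by (intro commutator_H)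
    have "associator x g b \<in> H (q + p)"
      using Suc.prems g by (intro associator)
    moreover have "commutator b x \<cdot> g \<in> H (q + p)"
      using IH(1)[OF _ bx g] by (simp del: H.simps)
    moreover have xg: "commutator b (x \<cdot> g) \<in> H (q + p)"
      using commutator_H[OF _ IH(1)[OF _ _ g]] Suc by fastforce
    ultimately have "x \<cdot> commutator b g \<in> H (q + p)"
      by (simp add: mult_commutator associator_commutator[of b] H_diff del: H.simps)
    moreover have "commutator b (commutator x g) \<in> H (Suc (q + p))"
      using Suc.prems g by (intro commutator_H IH) auto
    moreover have "commutator (commutator b x) g \<in> H (Suc q + p)"
      using bx g by (intro IH) auto
    ultimately have "x \<cdot> commutator b g \<in> H (q + p)"
      and "commutator x (commutator b g) \<in> H (Suc (q + p))"
      by (simp_all add: jacobi_identity[of x b g] H_diff del: H.simps)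
    then show "x \<cdot> commutator b g \<in> H (q + p)
        \<and> commutator x (commutator b g) \<in> H (Suc (q + p))" ..
  next
    fix b g w
    let ?c = "commutator b g"
    assume g: "g \<in> H p"
      and "?c \<in> {v. x \<cdot> v \<in> H (q + p) \<and> commutator x v \<in> H (Suc (q + p))}"
    then have c: "x \<cdot> ?c \<in> H (q + p)" "commutator x ?c \<in> H (Suc (q + p))" by blast+
    have "associator (commutator b x) g w \<in> H (Suc q + p)"
      using Suc.prems g by (intro associator commutator_H) auto
    moreover have "associator b (commutator x g) w \<in> H (Suc (q + p))"
      using Suc.prems g by (intro associator_H_middle IH) auto
    ultimately have a: "associator x ?c w \<in> H (Suc (q + p))"
      by (simp add: associator_commutator_middle[of x b g w] H_add del: H.simps)
    then have "associator x ?c w \<in> H (q + p)"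
      using H_decreasing[of "q + p"] Suc.prems by (auto simp del: H.simps)
    moreover have "x \<cdot> (?c \<cdot> w) = (x \<cdot> ?c) \<cdot> w - associator x ?c w"
      by (simp add: associator_def)
    ultimately have "x \<cdot> (?c \<cdot> w) \<in> H (q + p)"
      using c(1) by (simp add: H_diff H_mult_right del: H.simps)
    moreover have "commutator x (?c \<cdot> w) = commutator x ?c \<cdot> w - associator x ?c w"
      by (simp add: associator_commutator)
    then have "commutator x (?c \<cdot> w) \<in> H (Suc (q + p))"
      using c(2) a by (simp add: H_diff H_mult_right del: H.simps)
    ultimately show "x \<cdot> (?c \<cdot> w) \<in> H (q + p) \<and> commutator x (?c \<cdot> w) \<in> H (Suc (q + p))" ..
  qed
  then show ?case using Suc by (auto simp: H_Suc simp del: H.simps)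
qed

end

section \<open>Products in the commutator series and nilpotency\<close>

theorem theorem2p5:
  fixes scale :: "'f::field \<Rightarrow> 'v::ab_group_add \<Rightarrow> 'v"
    and mult :: "'v \<Rightarrow> 'v \<Rightarrow> 'v"
    and A :: "nat \<Rightarrow> 'v set"
  assumes "novikov_algebra scale mult \<or> bicommutative_algebra scale mult"
    and "A 1 = UNIV"
    and "\<forall>i\<ge>1. nonassoc_algebra.two_sided_ideal scale mult (A i)"
    and "\<forall>i\<ge>1. A (i + 1) \<subseteq> A i"
    and "\<forall>i\<ge>1. nonassoc_algebra.circ scale mult UNIV (A i) \<subseteq> A (i + 1)"
  shows "(\<forall>p\<ge>1. \<forall>q\<ge>1.
            nonassoc_algebra.product_space scale mult
              (nonassoc_algebra.H scale mult p) (nonassoc_algebra.H scale mult q)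
            \<subseteq> nonassoc_algebra.H scale mult (p + q - 1))
       \<and> (nonassoc_algebra.finite_class scale mult \<longrightarrow>
            nonassoc_algebra.nilpotent scale mult (nonassoc_algebra.circ scale mult UNIV UNIV)
          \<and> ((UNIV :: 'v set) \<noteq> {0} \<longrightarrow>
               nonassoc_algebra.nilpotent_index scale mult
                 (nonassoc_algebra.circ scale mult UNIV UNIV)
               \<le> nonassoc_algebra.algebra_class scale mult))"
proof -
  have alg: "nonassoc_algebra scale mult"
    using assms(1) by (auto dest: novikov_algebra.axioms bicommutative_algebra.axioms)
  interpret nonassoc_algebra scale mult by (rule alg)
  have "mult x y \<in> H (p + q - 1)" if "1 \<le> p" "1 \<le> q" "x \<in> H p" "y \<in> H q" for p q x y
    using assms(1) that novikov_algebra.mult_commutator_H_H bicommutative_algebra.mult_commutator_H_H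
    by blast
  then have "\<forall>p\<ge>1. \<forall>q\<ge>1. product_space (H p) (H q) \<subseteq> H (p + q - 1)"
    using product_space_H_subset by blast
  then show ?thesis
    using circ_UNIV_nilpotent by blast
qed

end
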